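(* Let $(C,S)$ be an action, i.e. sets $C$ and $S$ together with a function $C\times S\to C$, $(c,s)\mapsto cs$. Then $(C,S)$ is an $\uparrow\downarrow$-action if and only if all of the following hold: (i) it is idempotent ($css=cs$ for all $c\in C$, $s\in S$); (ii) it is previous redundant ($csts=cts$ for all $c\in C$, $s,t\in S$); (iii) all strong links in $(C,S)$ are trivial (whenever there is a strong link between $c$ and $d$ in $C$, then $c=d$).
   Context: An action $(C,S)$ consists of sets $C$, $S$ and a function $f\colon C\times S\to C$; write $cs$ for $f(c,s)$. It is regarded as a two-sorted algebra with one function symbol; homomorphisms, subalgebras and isomorphisms are those of two-sorted algebras (a pair of maps, one on each sort, respecting the operation). $S^*$ denotes the set of finite words in $S$, including the empty word; for $c\in C$ and $w=s_1\cdots s_k\in S^*$, $cw=(\cdots((cs_1)s_2)\cdots)s_k$ (and $cw=c$ for $w$ empty). For a set $X$, the full $\uparrow\downarrow$-action $F(X)$ on $X$ is the action with $C=\{c\mid c\subseteq X\}$, $S=\{(s^\downarrow,s^\uparrow)\mid s^\uparrow\subseteq s^\downarrow\subseteq X\}$ and $c\,(s^\downarrow,s^\uparrow)=(c\cap s^\downarrow)\cup s^\uparrow$. An action is an $\uparrow\downarrow$-action if it is isomorphic to a subalgebra of $F(X)$ for some set $X$. A strong link between $c,d\in C$ consists of some $n\ge 0$, elements $a_0,a_1,\dots,a_n\in C$ with $a_0=c$ and $a_n=d$, and words $w_1,\dots,w_n\in S^*$ such that for every $i=1,\dots,n$: $a_{i-1}w_i=a_{i-1}$, $a_iw_i=a_i$,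 and $cw_i=dw_i$. A strong link between $c$ and $d$ is trivial if $c=d$. *)

theory Defs
  imports Main
begin

text \<open>An action is a carrier pair \<open>C\<close>, \<open>S\<close> together with \<open>f\<close>, of which only the restriction to
  \<open>C \<times> S\<close> matters. Both carriers may be empty, also for subactions.\<close>

definition action :: "'c set \<Rightarrow> 's set \<Rightarrow> ('c \<Rightarrow> 's \<Rightarrow> 'c) \<Rightarrow> bool" where
  "action C S f \<longleftrightarrow> (\<forall>c\<in>C. \<forall>s\<in>S. f c s \<in> C)"

definition subaction ::
  "'c set \<Rightarrow> 's set \<Rightarrow> 'c set \<Rightarrow> 's set \<Rightarrow> ('c \<Rightarrow> 's \<Rightarrow> 'c) \<Rightarrow> bool" where
  "subaction C' S' C S f \<longleftrightarrow> C' \<subseteq> C \<and> S' \<subseteq> S \<and> action C' S' f"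

definition action_hom ::
  "('c \<Rightarrow> 'd) \<Rightarrow> ('s \<Rightarrow> 't) \<Rightarrow> 'c set \<Rightarrow> 's set \<Rightarrow> ('c \<Rightarrow> 's \<Rightarrow> 'c)
    \<Rightarrow> 'd set \<Rightarrow> 't set \<Rightarrow> ('d \<Rightarrow> 't \<Rightarrow> 'd) \<Rightarrow> bool" where
  "action_hom \<phi> \<psi> C S f D T g \<longleftrightarrow>
     (\<forall>c\<in>C. \<phi> c \<in> D) \<and> (\<forall>s\<in>S. \<psi> s \<in> T) \<and>
     (\<forall>c\<in>C. \<forall>s\<in>S. \<phi> (f c s) = g (\<phi> c) (\<psi> s))"

definition action_iso ::
  "('c \<Rightarrow> 'd) \<Rightarrow> ('s \<Rightarrow> 't) \<Rightarrow> 'c set \<Rightarrow> 's set \<Rightarrow> ('c \<Rightarrow> 's \<Rightarrow> 'c)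
    \<Rightarrow> 'd set \<Rightarrow> 't set \<Rightarrow> ('d \<Rightarrow> 't \<Rightarrow> 'd) \<Rightarrow> bool" where
  "action_iso \<phi> \<psi> C S f D T g \<longleftrightarrow>
     action_hom \<phi> \<psi> C S f D T g \<and> bij_betw \<phi> C D \<and> bij_betw \<psi> S T"

text \<open>The full up-down-action on \<open>X\<close>; a pair in \<open>full_S X\<close> is (down part, up part).\<close>

definition full_C :: "'x set \<Rightarrow> 'x set set" where
  "full_C X = {c. c \<subseteq> X}"

definition full_S :: "'x set \<Rightarrow> ('x set \<times> 'x set) set" where
  "full_S X = {(sd, su). su \<subseteq> sd \<and> sd \<subseteq> X}"

definition full_op :: "'x set \<Rightarrow> 'x set \<times> 'x set \<Rightarrow> 'x set" where
  "full_op c s = (c \<inter> fst s) \<union> snd s"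

definition updown_action_on ::
  "'x set \<Rightarrow> 'c set \<Rightarrow> 's set \<Rightarrow> ('c \<Rightarrow> 's \<Rightarrow> 'c) \<Rightarrow> bool" where
  "updown_action_on X C S f \<longleftrightarrow>
     (\<exists>C' S' \<phi> \<psi>. subaction C' S' (full_C X) (full_S X) full_op \<and>
        action_iso \<phi> \<psi> C S f C' S' full_op)"

text \<open>``For some set \<open>X\<close>'' must name a type of elements of \<open>X\<close>. The type chosen here loses
  nothing: by \<open>updown_action_onI\<close> below, an action isomorphic to a subaction of the full
  up-down-action on a set of any type is an up-down-action in the sense of this definition.\<close>

definition updown_action :: "'c set \<Rightarrow> 's set \<Rightarrow> ('c \<Rightarrow> 's \<Rightarrow> 'c) \<Rightarrow> bool" where
  "updown_action C S f \<longleftrightarrow>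
     (\<exists>X :: ('c set \<times> 's set \<times> 's set) set. updown_action_on X C S f)"

lemma updown_action_onI:
  fixes X :: "'x set" and C :: "'c set" and S :: "'s set"
  assumes act: "action C S f" and "updown_action_on X C S f"
  shows "updown_action C S f"
proof -
  from assms(2) obtain C' S' \<phi> \<psi>
    where sub: "subaction C' S' (full_C X) (full_S X) full_op"
      and iso: "action_iso \<phi> \<psi> C S f C' S' full_op"
    unfolding updown_action_on_def by blast
  have bC: "bij_betw \<phi> C C'" and bS: "bij_betw \<psi> S S'"
    and op: "\<And>c s. c \<in> C \<Longrightarrow> s \<in> S \<Longrightarrow> \<phi> (f c s) = full_op (\<phi> c) (\<psi> s)"
    using iso unfolding action_iso_def action_hom_def by auto
  define tag :: "'x \<Rightarrow> 'c set \<times> 's set \<times> 's set" where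
    "tag x = ({c \<in> C. x \<in> \<phi> c}, {s \<in> S. x \<in> fst (\<psi> s)}, {s \<in> S. x \<in> snd (\<psi> s)})" for x
  have mC: "tag x \<in> tag ` \<phi> c \<longleftrightarrow> x \<in> \<phi> c" if "c \<in> C" for x c
    using that unfolding tag_def by blast
  have mD: "tag x \<in> tag ` fst (\<psi> s) \<longleftrightarrow> x \<in> fst (\<psi> s)" if "s \<in> S" for x s
    using that unfolding tag_def by blast
  have mU: "tag x \<in> tag ` snd (\<psi> s) \<longleftrightarrow> x \<in> snd (\<psi> s)" if "s \<in> S" for x s
    using that unfolding tag_def by blast
  define \<phi>' where "\<phi>' c = tag ` \<phi> c" for c
  define \<psi>' where "\<psi>' s = (tag ` fst (\<psi> s), tag ` snd (\<psi> s))" for s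
  have injC: "inj_on \<phi>' C"
  proof (rule inj_onI)
    fix c d assume "c \<in> C" "d \<in> C" "\<phi>' c = \<phi>' d"
    then have "\<phi> c = \<phi> d" using mC unfolding \<phi>'_def by blast
    then show "c = d" using bC \<open>c \<in> C\<close> \<open>d \<in> C\<close> unfolding bij_betw_def inj_on_def by blast
  qed
  have injS: "inj_on \<psi>' S"
  proof (rule inj_onI)
    fix s t assume st: "s \<in> S" "t \<in> S" "\<psi>' s = \<psi>' t"
    then have "fst (\<psi> s) = fst (\<psi> t)" using mD unfolding \<psi>'_def by blast
    moreover from st have "snd (\<psi> s) = snd (\<psi> t)" using mU unfolding \<psi>'_def by blast
    ultimately have "\<psi> s = \<psi> t" by (rule prod_eqI)
    then show "s = t" using bS st unfolding bij_betw_def inj_on_def by blast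
  qed
  have op': "\<phi>' (f c s) = full_op (\<phi>' c) (\<psi>' s)" if "c \<in> C" "s \<in> S" for c s
  proof -
    have "\<phi>' (f c s) = tag ` (\<phi> c \<inter> fst (\<psi> s) \<union> snd (\<psi> s))"
      using op that unfolding \<phi>'_def full_op_def by simp
    also have "\<dots> = (tag ` \<phi> c \<inter> tag ` fst (\<psi> s)) \<union> tag ` snd (\<psi> s)"
      using mC[OF that(1)] mD[OF that(2)] by blast
    finally show ?thesis unfolding \<phi>'_def \<psi>'_def full_op_def by simp
  qed
  have X': "\<phi>' c \<subseteq> tag ` X" if "c \<in> C" for c
    using sub bC that unfolding subaction_def full_C_def bij_betw_def \<phi>'_def by blast
  have S': "\<psi>' s \<in> full_S (tag ` X)" if "s \<in> S" for s
  proof -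
    have "\<psi> s \<in> full_S X"
      using sub bS that unfolding subaction_def bij_betw_def by blast
    then have "snd (\<psi> s) \<subseteq> fst (\<psi> s)" "fst (\<psi> s) \<subseteq> X"
      unfolding full_S_def by auto
    then show ?thesis unfolding full_S_def \<psi>'_def by auto
  qed
  have "subaction (\<phi>' ` C) (\<psi>' ` S) (full_C (tag ` X)) (full_S (tag ` X)) full_op"
    using X' S' op' act unfolding subaction_def action_def full_C_def
    by (auto simp flip: op')
  moreover have "action_iso \<phi>' \<psi>' C S f (\<phi>' ` C) (\<psi>' ` S) full_op"
    using injC injS op' unfolding action_iso_def action_hom_def bij_betw_def by blast
  ultimately show ?thesis
    unfolding updown_action_def updown_action_on_def by blast
qed

text \<open>\<open>act_word f c w\<close> is \<open>c w\<close>: the letters of \<open>w\<close> act from left to right.\<close>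

definition act_word :: "('c \<Rightarrow> 's \<Rightarrow> 'c) \<Rightarrow> 'c \<Rightarrow> 's list \<Rightarrow> 'c" where
  "act_word f c w = foldl f c w"

definition idempotent_action :: "'c set \<Rightarrow> 's set \<Rightarrow> ('c \<Rightarrow> 's \<Rightarrow> 'c) \<Rightarrow> bool" where
  "idempotent_action C S f \<longleftrightarrow> (\<forall>c\<in>C. \<forall>s\<in>S. f (f c s) s = f c s)"

definition previous_redundant :: "'c set \<Rightarrow> 's set \<Rightarrow> ('c \<Rightarrow> 's \<Rightarrow> 'c) \<Rightarrow> bool" where
  "previous_redundant C S f \<longleftrightarrow>
     (\<forall>c\<in>C. \<forall>s\<in>S. \<forall>t\<in>S. f (f (f c s) t) s = f (f c t) s)"

definition strong_link ::
  "'c set \<Rightarrow> 's set \<Rightarrow> ('c \<Rightarrow> 's \<Rightarrow> 'c) \<Rightarrow> 'c \<Rightarrow> 'c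
    \<Rightarrow> nat \<Rightarrow> (nat \<Rightarrow> 'c) \<Rightarrow> (nat \<Rightarrow> 's list) \<Rightarrow> bool" where
  "strong_link C S f c d n a w \<longleftrightarrow>
     (\<forall>i\<in>{0..n}. a i \<in> C) \<and> a 0 = c \<and> a n = d \<and>
     (\<forall>i\<in>{1..n}. w i \<in> lists S \<and>
        act_word f (a (i - 1)) (w i) = a (i - 1) \<and>
        act_word f (a i) (w i) = a i \<and>
        act_word f c (w i) = act_word f d (w i))"

end

theory Submission
  imports Defs
begin

text \<open>
  A point \<open>x\<close> of \<open>X\<close> reduces a subaction of the full up-down-action on \<open>X\<close> to a single bit
  (``is \<open>x\<close> in \<open>c\<close>?''), on which every \<open>s\<close> acts as the identity or as one of the two constants.
  Conversely a set \<open>P\<close> on whose membership bit every \<open>s\<close> acts in this way, called a coordinate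
  below, can serve as a point of \<open>X\<close>. So the up-down-actions are exactly the
  actions whose coordinates separate the elements of \<open>C\<close> (\<open>updown_action_iff_coordinates_separate\<close>);
  elements of \<open>S\<close> that act alike can be told apart by points lying in no element of \<open>C\<close>.

  If coordinates separate, idempotence and previous redundancy hold because they hold for
  the identity and the constants on one bit. A strong link from \<open>c\<close> to \<open>d\<close> is trivial: on a bit
  separating \<open>c\<close> from \<open>d\<close>, each word \<open>w\<close> of the link has \<open>cw = dw\<close>, so it acts as a constant, and
  all of its fixed points have the same bit; thus the bit does not change along the link.

  For the converse let \<open>c \<noteq> d\<close>. On a coordinate separating \<open>c\<close> from \<open>d\<close> some set \<open>T\<close> of letters
  acts as the identity, and then no word in \<open>T\<close> identifies \<open>c\<close> with \<open>d\<close>. The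
  construction starts from a \<open>T\<close> maximal with the latter property. Making the other letters constant
  forces an equivalence relation on \<open>C\<close>: \<open>a\<close> is equivalent to \<open>at\<close> for \<open>t\<close> in \<open>T\<close>, and all
  elements of \<open>Cu\<close> are equivalent for \<open>u\<close> outside \<open>T\<close>. The class of \<open>c\<close> is a
  coordinate, and it misses \<open>d\<close>: a finite chain of forced equivalences from \<open>c\<close> to \<open>d\<close> is turned,
  by applying a word \<open>v\<close> in \<open>T\<close> with sufficiently many letters, into a strong link from \<open>cv\<close>
  to \<open>dv\<close> (\<open>forced_chain_gives_links\<close>), whence \<open>cv = dv\<close>, against the choice of \<open>T\<close>.
\<close>

section \<open>Words\<close>

lemma act_word_simps [simp]:
  "act_word f c [] = c"
  "act_word f c (s # w) = act_word f (f c s) w"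
  "act_word f c (v @ w) = act_word f (act_word f c v) w"
  by (simp_all add: act_word_def)

lemma act_word_closed:
  assumes "action C S f" "c \<in> C" "w \<in> lists S"
  shows "act_word f c w \<in> C"
  using assms(3,2)
  by (induction w arbitrary: c) (use assms(1) in \<open>auto simp: action_def\<close>)

lemma previous_redundant_word:
  assumes act: "action C S f" and idem: "idempotent_action C S f"
    and prev: "previous_redundant C S f"
    and "c \<in> C" "s \<in> S" "w \<in> lists S"
  shows "f (act_word f (f c s) w) s = f (act_word f c w) s"
  using \<open>w \<in> lists S\<close>
proof (induction w rule: rev_induct)
  case Nil
  then show ?case using idem assms(4,5) by (simp add: idempotent_action_def)
next
  case (snoc t w)
  let ?b = "act_word f (f c s) w" and ?e = "act_word f c w"
  have IH: "f ?b s = f ?e s" and t: "t \<in> S"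
    using snoc by auto
  have "f c s \<in> C" using act assms(4,5) by (auto simp: action_def)
  then have "?b \<in> C" "?e \<in> C"
    using act_word_closed[OF act] snoc.prems assms(4) by auto
  \<comment> \<open>A letter \<open>s\<close> may be inserted before \<open>ts\<close>, which makes the induction hypothesis applicable.\<close>
  then have "f (f ?b t) s = f (f (f ?b s) t) s" "f (f ?e t) s = f (f (f ?e s) t) s"
    using prev t assms(5) by (simp_all add: previous_redundant_def)
  with IH show ?case by simp
qed

text \<open>Only the last occurrence of each letter in a word counts, so a prefix whose letters all
  occur later can be dropped.\<close>

lemma act_word_absorb:
  assumes act: "action C S f" and idem: "idempotent_action C S f"
    and prev: "previous_redundant C S f"
    and "c \<in> C" "v \<in> lists S" "set u \<subseteq> set v"
  shows "act_word f (act_word f c u) v = act_word f c v"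
  using \<open>c \<in> C\<close> \<open>set u \<subseteq> set v\<close>
proof (induction u arbitrary: c)
  case Nil
  then show ?case by simp
next
  case (Cons s u)
  then have s: "s \<in> S" using assms(5) by auto
  then have "f c s \<in> C" using act Cons.prems by (auto simp: action_def)
  then have "act_word f (act_word f c (s # u)) v = act_word f (f c s) v"
    using Cons by simp
  also have "\<dots> = act_word f c v"
  proof -
    obtain v1 v2 where v: "v = v1 @ s # v2"
      using Cons.prems(2) by (auto dest: split_list)
    then have "v1 \<in> lists S" using assms(5) by auto
    then show ?thesis
      using previous_redundant_word[OF act idem prev Cons.prems(1) s] v by simp
  qed
  finally show ?case .
qed

section \<open>Coordinates\<close>

definition bit_map :: "'c set \<Rightarrow> 'c set \<Rightarrow> ('c \<Rightarrow> 'c) \<Rightarrow> bool" where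
  "bit_map C P g \<longleftrightarrow>
     (\<forall>a\<in>C. g a \<in> P \<longleftrightarrow> a \<in> P) \<or> (\<forall>a\<in>C. g a \<in> P) \<or> (\<forall>a\<in>C. g a \<notin> P)"

text \<open>Equivalently, the bit \<open>c \<in> P\<close> is the first component of a homomorphism from the action
  to the full up-down-action on a one-element set.\<close>

definition coordinate :: "'c set \<Rightarrow> 's set \<Rightarrow> ('c \<Rightarrow> 's \<Rightarrow> 'c) \<Rightarrow> 'c set \<Rightarrow> bool" where
  "coordinate C S f P \<longleftrightarrow> (\<forall>s\<in>S. bit_map C P (\<lambda>a. f a s))"

definition coordinates_separate :: "'c set \<Rightarrow> 's set \<Rightarrow> ('c \<Rightarrow> 's \<Rightarrow> 'c) \<Rightarrow> bool" where
  "coordinates_separate C S f \<longleftrightarrow>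
     (\<forall>c\<in>C. \<forall>d\<in>C. (\<forall>P. coordinate C S f P \<longrightarrow> (c \<in> P \<longleftrightarrow> d \<in> P)) \<longrightarrow> c = d)"

lemma coordinates_separateD:
  assumes "coordinates_separate C S f" "c \<in> C" "d \<in> C"
    and "\<And>P. coordinate C S f P \<Longrightarrow> c \<in> P \<longleftrightarrow> d \<in> P"
  shows "c = d"
  using assms unfolding coordinates_separate_def by blast

lemma updown_action_imp_coordinates_separate:
  fixes C :: "'c set" and S :: "'s set"
  assumes "updown_action C S f"
  shows "coordinates_separate C S f"
proof -
  from assms obtain C' S' \<psi> and \<phi> :: "'c \<Rightarrow> ('c set \<times> 's set \<times> 's set) set"
    where iso: "action_iso \<phi> \<psi> C S f C' S' full_op"
    unfolding updown_action_def updown_action_on_def by blast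
  have inj: "inj_on \<phi> C"
    and op: "\<And>c s. c \<in> C \<Longrightarrow> s \<in> S \<Longrightarrow> \<phi> (f c s) = full_op (\<phi> c) (\<psi> s)"
    using iso unfolding action_iso_def action_hom_def bij_betw_def by auto
  have coord: "coordinate C S f {a. x \<in> \<phi> a}" for x
    using op unfolding coordinate_def bit_map_def full_op_def by auto
  show ?thesis
    unfolding coordinates_separate_def
  proof (intro ballI impI)
    fix c d assume cd: "c \<in> C" "d \<in> C"
      and "\<forall>P. coordinate C S f P \<longrightarrow> (c \<in> P \<longleftrightarrow> d \<in> P)"
    with coord have "x \<in> \<phi> c \<longleftrightarrow> x \<in> \<phi> d" for x by blast
    then have "\<phi> c = \<phi> d" by blast
    then show "c = d" using inj cd by (simp add: inj_on_def)
  qed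
qed

lemma coordinates_separate_imp_updown_action:
  fixes C :: "'c set" and S :: "'s set"
  assumes act: "action C S f" and sep: "coordinates_separate C S f"
  shows "updown_action C S f"
proof -
  \<comment> \<open>The points are the coordinates and, to make the second map injective, the elements of \<open>S\<close>:
    \<open>Inr s\<close> lies in the down part of \<open>s\<close> and nowhere else.\<close>
  define up where "up s = {P. coordinate C S f P \<and> (\<forall>a\<in>C. f a s \<in> P)}" for s
  define pres where "pres s = {P. coordinate C S f P \<and> (\<forall>a\<in>C. f a s \<in> P \<longleftrightarrow> a \<in> P)}" for s
  define \<phi> :: "'c \<Rightarrow> ('c set + 's) set" where "\<phi> c = Inl ` {P. coordinate C S f P \<and> c \<in> P}" for c
  define \<psi> :: "'s \<Rightarrow> ('c set + 's) set \<times> ('c set + 's) set"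
    where "\<psi> s = (insert (Inr s) (Inl ` (pres s \<union> up s)), Inl ` up s)" for s
  have injC: "inj_on \<phi> C"
  proof (rule inj_onI)
    fix c d assume cd: "c \<in> C" "d \<in> C" "\<phi> c = \<phi> d"
    then have "c \<in> P \<longleftrightarrow> d \<in> P" if "coordinate C S f P" for P
      using that unfolding \<phi>_def by blast
    then show "c = d" using coordinates_separateD[OF sep cd(1,2)] by blast
  qed
  have injS: "inj_on \<psi> S"
    unfolding \<psi>_def inj_on_def by blast
  have op: "\<phi> (f c s) = full_op (\<phi> c) (\<psi> s)" if "c \<in> C" "s \<in> S" for c s
  proof -
    have "f c s \<in> P \<longleftrightarrow> c \<in> P \<and> P \<in> pres s \<or> P \<in> up s" if P: "coordinate C S f P" for P
    proof -
      have "bit_map C P (\<lambda>a. f a s)"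
        using P \<open>s \<in> S\<close> by (simp add: coordinate_def)
      then show ?thesis
        using P \<open>c \<in> C\<close> unfolding bit_map_def up_def pres_def by blast
    qed
    moreover have "P \<in> up s \<Longrightarrow> coordinate C S f P" for P
      by (simp add: up_def)
    ultimately show ?thesis
      unfolding \<phi>_def \<psi>_def full_op_def by auto
  qed
  have "subaction (\<phi> ` C) (\<psi> ` S) (full_C UNIV) (full_S UNIV) full_op"
  proof -
    have "\<psi> ` S \<subseteq> full_S UNIV"
      unfolding full_S_def \<psi>_def by auto
    then show ?thesis
      using act unfolding subaction_def action_def full_C_def by (auto simp flip: op)
  qed
  moreover have "action_iso \<phi> \<psi> C S f (\<phi> ` C) (\<psi> ` S) full_op"
    using injC injS op unfolding action_iso_def action_hom_def bij_betw_def by blast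
  ultimately have "updown_action_on (UNIV :: ('c set + 's) set) C S f"
    unfolding updown_action_on_def by (intro exI conjI)
  with act show ?thesis by (rule updown_action_onI)
qed

lemma updown_action_iff_coordinates_separate:
  assumes "action C S f"
  shows "updown_action C S f \<longleftrightarrow> coordinates_separate C S f"
  using updown_action_imp_coordinates_separate coordinates_separate_imp_updown_action[OF assms]
  by blast

section \<open>Necessity\<close>

lemma coordinates_separate_imp_idempotent:
  assumes act: "action C S f" and sep: "coordinates_separate C S f"
  shows "idempotent_action C S f"
  unfolding idempotent_action_def
proof (intro ballI)
  fix c s assume "c \<in> C" "s \<in> S"
  moreover from this have cs: "f c s \<in> C" "f (f c s) s \<in> C"
    using act by (auto simp: action_def)
  ultimately show "f (f c s) s = f c s"
    by (intro coordinates_separateD[OF sep]) (auto simp: coordinate_def bit_map_def)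
qed

lemma coordinates_separate_imp_previous_redundant:
  assumes act: "action C S f" and sep: "coordinates_separate C S f"
  shows "previous_redundant C S f"
  unfolding previous_redundant_def
proof (intro ballI)
  fix c s t assume c: "c \<in> C" and st: "s \<in> S" "t \<in> S"
  then have mem: "f c s \<in> C" "f c t \<in> C" "f (f c s) t \<in> C"
    "f (f (f c s) t) s \<in> C" "f (f c t) s \<in> C"
    using act by (auto simp: action_def)
  show "f (f (f c s) t) s = f (f c t) s"
  proof (rule coordinates_separateD[OF sep])
    fix P assume "coordinate C S f P"
    then have "bit_map C P (\<lambda>a. f a s)" "bit_map C P (\<lambda>a. f a t)"
      using st by (auto simp: coordinate_def)
    then show "f (f (f c s) t) s \<in> P \<longleftrightarrow> f (f c t) s \<in> P"
      using c mem unfolding bit_map_def by metis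
  qed (use mem in auto)
qed

text \<open>The identity and the constants on a bit are closed under composition.\<close>

lemma coordinate_word:
  assumes act: "action C S f" and P: "coordinate C S f P" and w: "w \<in> lists S"
  shows "bit_map C P (\<lambda>a. act_word f a w)"
  using w
proof (induction w)
  case Nil
  then show ?case by (simp add: bit_map_def)
next
  case (Cons s w)
  then have "bit_map C P (\<lambda>a. f a s)" "bit_map C P (\<lambda>a. act_word f a w)"
    "\<And>a. a \<in> C \<Longrightarrow> f a s \<in> C"
    using P act by (auto simp: coordinate_def action_def)
  then show ?case unfolding bit_map_def act_word_simps by meson
qed

lemma coordinates_separate_imp_strong_links_trivial:
  assumes act: "action C S f" and sep: "coordinates_separate C S f"
    and cd: "c \<in> C" "d \<in> C" and link: "strong_link C S f c d n a w"
  shows "c = d"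
proof (rule coordinates_separateD[OF sep cd])
  fix P assume P: "coordinate C S f P"
  show "c \<in> P \<longleftrightarrow> d \<in> P"
  proof (rule ccontr)
    assume diff: "\<not> (c \<in> P \<longleftrightarrow> d \<in> P)"
    have "a i \<in> P \<longleftrightarrow> c \<in> P" if "i \<le> n" for i
      using that
    proof (induction i)
      case 0
      then show ?case using link by (simp add: strong_link_def)
    next
      case (Suc i)
      then have mem: "a i \<in> C" "a (Suc i) \<in> C"
        using link by (simp_all add: strong_link_def)
      have "Suc i \<in> {1..n}" using Suc.prems by simp
      with link have "w (Suc i) \<in> lists S \<and> act_word f (a (Suc i - 1)) (w (Suc i)) = a (Suc i - 1) \<and>
          act_word f (a (Suc i)) (w (Suc i)) = a (Suc i) \<and>
          act_word f c (w (Suc i)) = act_word f d (w (Suc i))"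
        unfolding strong_link_def by blast
      then have w: "w (Suc i) \<in> lists S"
        and fixed: "act_word f (a i) (w (Suc i)) = a i"
          "act_word f (a (Suc i)) (w (Suc i)) = a (Suc i)"
        and same: "act_word f c (w (Suc i)) = act_word f d (w (Suc i))"
        by simp_all
      have "a i \<in> P \<longleftrightarrow> a (Suc i) \<in> P"
        using coordinate_word[OF act P w] mem fixed same cd diff
        unfolding bit_map_def by metis
      with Suc show ?case by simp
    qed
    from this[of n] link diff show False by (simp add: strong_link_def)
  qed
qed

section \<open>Sufficiency\<close>

definition link_step ::
  "'c set \<Rightarrow> 's set \<Rightarrow> ('c \<Rightarrow> 's \<Rightarrow> 'c) \<Rightarrow> 'c \<Rightarrow> 'c \<Rightarrow> 'c \<Rightarrow> 'c \<Rightarrow> bool" where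
  "link_step C S f c d x y \<longleftrightarrow> x \<in> C \<and> y \<in> C \<and>
     (\<exists>w\<in>lists S. act_word f x w = x \<and> act_word f y w = y \<and> act_word f c w = act_word f d w)"

lemma link_steps_imp_strong_link:
  assumes c: "c \<in> C" and steps: "(link_step C S f c d)\<^sup>*\<^sup>* c d"
  shows "\<exists>n a w. strong_link C S f c d n a w"
proof -
  obtain n where "(link_step C S f c d ^^ n) c d"
    using rtranclp_imp_relpowp[OF steps] by blast
  then obtain a where a: "a 0 = c" "a n = d" "\<And>i. i < n \<Longrightarrow> link_step C S f c d (a i) (a (Suc i))"
    unfolding relpowp_fun_conv by blast
  have step: "link_step C S f c d (a (i - 1)) (a i)" if "i \<in> {1..n}" for i
    using a(3)[of "i - 1"] that by (cases i) auto
  have "\<forall>i\<in>{1..n}. \<exists>w. w \<in> lists S \<and> act_word f (a (i - 1)) w = a (i - 1) \<and>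
      act_word f (a i) w = a i \<and> act_word f c w = act_word f d w"
    using step unfolding link_step_def by blast
  from bchoice[OF this] obtain w where
    w: "\<forall>i\<in>{1..n}. w i \<in> lists S \<and> act_word f (a (i - 1)) (w i) = a (i - 1) \<and>
      act_word f (a i) (w i) = a i \<and> act_word f c (w i) = act_word f d (w i)" ..
  have "a i \<in> C" if "i \<le> n" for i
  proof (cases "i = 0")
    case True
    then show ?thesis using a(1) c by simp
  next
    case False
    then show ?thesis using step[of i] that by (simp add: link_step_def)
  qed
  then have "strong_link C S f c d n a w"
    using a(1,2) w unfolding strong_link_def by simp
  then show ?thesis by blast
qed

definition separating_letters :: "'s set \<Rightarrow> ('c \<Rightarrow> 's \<Rightarrow> 'c) \<Rightarrow> 'c \<Rightarrow> 'c \<Rightarrow> 's set \<Rightarrow> bool" where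
  "separating_letters S f c d T \<longleftrightarrow>
     T \<subseteq> S \<and> (\<forall>w\<in>lists T. act_word f c w \<noteq> act_word f d w)"

text \<open>A word has finitely many letters, so the property has finite character and Zorn's lemma
  applies.\<close>

lemma maximal_separating_letters:
  assumes "c \<noteq> d"
  obtains T where "separating_letters S f c d T"
    and "\<And>u. u \<in> S - T \<Longrightarrow> \<exists>w\<in>lists (insert u T). act_word f c w = act_word f d w"
proof -
  let ?A = "Collect (separating_letters S f c d)"
  have "\<exists>T\<in>?A. \<forall>U\<in>?A. T \<subseteq> U \<longrightarrow> U = T"
  proof (rule subset_Zorn_nonempty)
    show "?A \<noteq> {}"
      using assms by (auto simp: separating_letters_def intro!: exI[of _ "{}"])
  next
    fix K assume K: "K \<noteq> {}" "subset.chain ?A K"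
    have "act_word f c w \<noteq> act_word f d w" if w: "w \<in> lists (\<Union>K)" for w
    proof -
      have "set w \<subseteq> \<Union>K" using w by auto
      then obtain U where "U \<in> K" "set w \<subseteq> U"
        using finite_subset_Union_chain[OF finite_set _ K] by metis
      moreover from \<open>U \<in> K\<close> have "separating_letters S f c d U"
        using K(2) by (auto simp: subset_chain_def)
      ultimately show ?thesis unfolding separating_letters_def by auto
    qed
    moreover have "\<Union>K \<subseteq> S"
      using K(2) unfolding subset_chain_def separating_letters_def by blast
    ultimately show "\<Union>K \<in> ?A" by (simp add: separating_letters_def)
  qed
  then obtain T where T: "separating_letters S f c d T"
    and max: "\<And>U. separating_letters S f c d U \<Longrightarrow> T \<subseteq> U \<Longrightarrow> U = T"
    by auto
  have "\<exists>w\<in>lists (insert u T). act_word f c w = act_word f d w" if u: "u \<in> S - T" for u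
  proof (rule ccontr)
    assume "\<not> ?thesis"
    then have "separating_letters S f c d (insert u T)"
      using T u by (auto simp: separating_letters_def)
    then have "insert u T = T" using max by blast
    then show False using u by blast
  qed
  with T show thesis by (rule that)
qed

text \<open>Pairs that every coordinate with \<open>T\<close> acting as the identity and \<open>S - T\<close> acting by
  constants must leave unseparated.\<close>

definition forced_step ::
  "'c set \<Rightarrow> 's set \<Rightarrow> ('c \<Rightarrow> 's \<Rightarrow> 'c) \<Rightarrow> 's set \<Rightarrow> 'c \<Rightarrow> 'c \<Rightarrow> bool" where
  "forced_step C S f T a b \<longleftrightarrow> a \<in> C \<and> b \<in> C \<and>
     ((\<exists>t\<in>T. b = f a t \<or> a = f b t) \<or> (\<exists>u\<in>S - T. \<exists>p\<in>C. \<exists>q\<in>C. a = f p u \<and> b = f q u))"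

lemma coordinate_forced_class:
  assumes act: "action C S f" and "T \<subseteq> S"
  shows "coordinate C S f {a. (forced_step C S f T)\<^sup>*\<^sup>* c a}" (is "coordinate C S f ?P")
  unfolding coordinate_def
proof
  fix s assume s: "s \<in> S"
  have closed: "f a s \<in> C" if "a \<in> C" for a
    using that s act by (simp add: action_def)
  have ext: "b \<in> ?P" if "a \<in> ?P" "forced_step C S f T a b" for a b
    using that by (auto intro: rtranclp.rtrancl_into_rtrancl)
  show "bit_map C ?P (\<lambda>a. f a s)"
  proof (cases "s \<in> T")
    case True
    have "f a s \<in> ?P \<longleftrightarrow> a \<in> ?P" if "a \<in> C" for a
    proof -
      have "forced_step C S f T a (f a s)" "forced_step C S f T (f a s) a"
        using that True closed unfolding forced_step_def by blast+
      then show ?thesis using ext by blast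
    qed
    then show ?thesis unfolding bit_map_def by blast
  next
    case False
    have "f b s \<in> ?P" if "f a s \<in> ?P" "a \<in> C" "b \<in> C" for a b
    proof -
      have "forced_step C S f T (f a s) (f b s)"
        using that(2,3) False s closed unfolding forced_step_def by blast
      then show ?thesis using ext that(1) by blast
    qed
    then show ?thesis unfolding bit_map_def by blast
  qed
qed

text \<open>A forced step \<open>a, at\<close> collapses under any word containing \<open>t\<close>. For a forced step
  \<open>pu, qu\<close> take a word \<open>w\<close> in \<open>T \<union> {u}\<close> with \<open>cw = dw\<close>; if \<open>v\<close> contains all letters of \<open>w\<close> other
  than \<open>u\<close>, then \<open>uv\<close> absorbs \<open>w\<close>, so \<open>uv\<close> identifies \<open>cv\<close> with \<open>dv\<close> while fixing \<open>puv\<close> and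
  \<open>quv\<close>. Both remain true for words with more letters from \<open>T\<close>, hence a common word serves for
  a whole chain.\<close>

lemma forced_step_gives_links:
  assumes act: "action C S f" and idem: "idempotent_action C S f"
    and prev: "previous_redundant C S f" and cd: "c \<in> C" "d \<in> C"
    and T: "T \<subseteq> S"
    and max: "\<And>u. u \<in> S - T \<Longrightarrow> \<exists>w\<in>lists (insert u T). act_word f c w = act_word f d w"
    and step: "forced_step C S f T a b"
  shows "\<exists>v0\<in>lists T. \<forall>v\<in>lists T. set v0 \<subseteq> set v \<longrightarrow>
    (link_step C S f (act_word f c v) (act_word f d v))\<^sup>*\<^sup>* (act_word f a v) (act_word f b v)"
proof -
  note absorb = act_word_absorb[OF act idem prev]
  have TS: "v \<in> lists S" if "v \<in> lists T" for v
    using that T by auto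
  have ab: "a \<in> C" "b \<in> C" using step by (auto simp: forced_step_def)
  consider t where "t \<in> T" "b = f a t \<or> a = f b t"
    | u p q where "u \<in> S - T" "p \<in> C" "q \<in> C" "a = f p u" "b = f q u"
    using step unfolding forced_step_def by blast
  then show ?thesis
  proof cases
    case (1 t)
    have "act_word f a v = act_word f b v" if "v \<in> lists T" "t \<in> set v" for v
      using absorb[OF ab(1) TS[OF that(1)], of "[t]"] absorb[OF ab(2) TS[OF that(1)], of "[t]"]
        that(2) 1(2) by auto
    then show ?thesis using 1(1) by (intro bexI[of _ "[t]"]) auto
  next
    case (2 u p q)
    obtain w where w: "w \<in> lists (insert u T)" "act_word f c w = act_word f d w"
      using max[OF 2(1)] by blast
    define v0 where "v0 = filter (\<lambda>s. s \<noteq> u) w"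
    have "v0 \<in> lists T" using w(1) by (auto simp: v0_def)
    moreover have "link_step C S f (act_word f c v) (act_word f d v) (act_word f a v) (act_word f b v)"
      if v: "v \<in> lists T" and sub: "set v0 \<subseteq> set v" for v
    proof -
      let ?uv = "u # v"
      have uv: "?uv \<in> lists S" using TS[OF v] 2(1) by simp
      have wuv: "set w \<subseteq> set ?uv" using sub by (auto simp: v0_def)
      have "act_word f c ?uv = act_word f (act_word f c w) ?uv"
        using absorb[OF cd(1) uv wuv] by (rule sym)
      also have "\<dots> = act_word f d ?uv"
        using absorb[OF cd(2) uv wuv] w(2) by (simp only:)
      finally have same: "act_word f c ?uv = act_word f d ?uv" .
      have "act_word f (act_word f c v) ?uv = act_word f (act_word f d v) ?uv"
        using absorb[OF cd(1) uv, of v] absorb[OF cd(2) uv, of v] same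
        by (metis set_subset_Cons)
      moreover have "act_word f (act_word f a v) ?uv = act_word f a v"
        "act_word f (act_word f b v) ?uv = act_word f b v"
        using absorb[OF 2(2) uv, of ?uv] absorb[OF 2(3) uv, of ?uv] 2(4,5) by simp_all
      moreover have "act_word f a v \<in> C" "act_word f b v \<in> C"
        using act_word_closed[OF act _ TS[OF v]] ab by blast+
      ultimately show ?thesis using uv unfolding link_step_def by blast
    qed
    ultimately show ?thesis by (intro bexI[of _ v0]) auto
  qed
qed

lemma forced_chain_gives_links:
  assumes act: "action C S f" and idem: "idempotent_action C S f"
    and prev: "previous_redundant C S f" and cd: "c \<in> C" "d \<in> C"
    and T: "T \<subseteq> S"
    and max: "\<And>u. u \<in> S - T \<Longrightarrow> \<exists>w\<in>lists (insert u T). act_word f c w = act_word f d w"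
    and chain: "(forced_step C S f T)\<^sup>*\<^sup>* a b"
  shows "\<exists>v0\<in>lists T. \<forall>v\<in>lists T. set v0 \<subseteq> set v \<longrightarrow>
    (link_step C S f (act_word f c v) (act_word f d v))\<^sup>*\<^sup>* (act_word f a v) (act_word f b v)"
  using chain
proof (induction rule: rtranclp_induct)
  case base
  show ?case by (intro bexI[of _ "[]"]) auto
next
  case (step y z)
  let ?L = "\<lambda>v. (link_step C S f (act_word f c v) (act_word f d v))\<^sup>*\<^sup>*"
  obtain v1 where v1: "v1 \<in> lists T"
    "\<And>v. v \<in> lists T \<Longrightarrow> set v1 \<subseteq> set v \<Longrightarrow> ?L v (act_word f a v) (act_word f y v)"
    using step.IH by blast
  obtain v2 where v2: "v2 \<in> lists T"
    "\<And>v. v \<in> lists T \<Longrightarrow> set v2 \<subseteq> set v \<Longrightarrow> ?L v (act_word f y v) (act_word f z v)"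
    using forced_step_gives_links[OF act idem prev cd T max step.hyps(2)] by blast
  have "?L v (act_word f a v) (act_word f z v)"
    if "v \<in> lists T" "set (v1 @ v2) \<subseteq> set v" for v
    using v1(2)[OF that(1)] v2(2)[OF that(1)] that(2) by (auto intro: rtranclp_trans)
  moreover have "v1 @ v2 \<in> lists T" using v1(1) v2(1) by simp
  ultimately show ?case by blast
qed

lemma strong_links_trivial_imp_coordinates_separate:
  assumes act: "action C S f" and idem: "idempotent_action C S f"
    and prev: "previous_redundant C S f"
    and triv: "\<And>c d n a w. c \<in> C \<Longrightarrow> d \<in> C \<Longrightarrow> strong_link C S f c d n a w \<Longrightarrow> c = d"
  shows "coordinates_separate C S f"
  unfolding coordinates_separate_def
proof (intro ballI impI, rule ccontr)
  fix c d assume cd: "c \<in> C" "d \<in> C"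
    and unsep: "\<forall>P. coordinate C S f P \<longrightarrow> (c \<in> P \<longleftrightarrow> d \<in> P)" and "c \<noteq> d"
  obtain T where T: "separating_letters S f c d T"
    and max: "\<And>u. u \<in> S - T \<Longrightarrow> \<exists>w\<in>lists (insert u T). act_word f c w = act_word f d w"
    using maximal_separating_letters[OF \<open>c \<noteq> d\<close>] by blast
  then have TS: "T \<subseteq> S" by (simp add: separating_letters_def)
  have "(forced_step C S f T)\<^sup>*\<^sup>* c d"
    using unsep coordinate_forced_class[OF act TS, of c] by blast
  from forced_chain_gives_links[OF act idem prev cd TS max this]
  obtain v where v: "v \<in> lists T"
    and links: "(link_step C S f (act_word f c v) (act_word f d v))\<^sup>*\<^sup>* (act_word f c v) (act_word f d v)"
    by blast
  have "v \<in> lists S" using v TS by auto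
  then have mem: "act_word f c v \<in> C" "act_word f d v \<in> C"
    using act_word_closed[OF act] cd by blast+
  have "act_word f c v = act_word f d v"
    using link_steps_imp_strong_link[OF mem(1) links] triv[OF mem] by blast
  with T v show False by (simp add: separating_letters_def)
qed

theorem theorem4p10:
  fixes C :: "'c set" and S :: "'s set" and f :: "'c \<Rightarrow> 's \<Rightarrow> 'c"
  assumes "action C S f"
  shows "updown_action C S f \<longleftrightarrow>
     idempotent_action C S f \<and>
     previous_redundant C S f \<and>
     (\<forall>c\<in>C. \<forall>d\<in>C. (\<exists>n a w. strong_link C S f c d n a w) \<longrightarrow> c = d)"
  (is "_ \<longleftrightarrow> ?idem \<and> ?prev \<and> ?triv")
proof -
  have "?idem \<and> ?prev \<and> ?triv" if "coordinates_separate C S f"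
    using coordinates_separate_imp_idempotent[OF assms that]
      coordinates_separate_imp_previous_redundant[OF assms that]
      coordinates_separate_imp_strong_links_trivial[OF assms that]
    by blast
  moreover have "coordinates_separate C S f" if "?idem \<and> ?prev \<and> ?triv"
    using that by (intro strong_links_trivial_imp_coordinates_separate[OF assms]) blast+
  ultimately show ?thesis
    unfolding updown_action_iff_coordinates_separate[OF assms] by blast
qed

end
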